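(* Let $X\in\mathbb{S}^n$, $C\in\mathbb{R}^{p\times n}$, let $\begin{bmatrix} Q_j & S_j\\ S_j^T & R_j\end{bmatrix}\in\mathbb{S}^{m+n}$ with $R_j\succ 0$ for $j=0,\dots,M$, and let $\gamma_1,\dots,\gamma_M\in\mathbb{R}$ be given. The team optimization problem $$\min_{\gamma_0\in\mathbb{R},\,K\in\mathbb{K}}\ \gamma_0\quad\text{subject to}\quad \mathbf{E}\begin{bmatrix} x\\ KCx\end{bmatrix}^T\begin{bmatrix} Q_j & S_j\\ S_j^T & R_j\end{bmatrix}\begin{bmatrix} x\\ KCx\end{bmatrix}\le\gamma_j,\quad j=0,\dots,M,\qquad x\sim\mathcal{N}(0,X^2),$$ is equivalent to the semidefinite program $$\min_{\gamma_0\in\mathbb{R},\,K\in\mathbb{K},\,P_0,\dots,P_M\in\mathbb{S}^n}\ \gamma_0$$ $$\text{subject to}\quad \mathbf{Tr}\,P_j\le\gamma_j,\qquad \begin{bmatrix} P_j-XQ_jX-XS_jKCX-XC^TK^TS_j^TX & XC^TK^TR_j\\ R_jKCX & R_j\end{bmatrix}\succeq 0,\qquad j=0,\dots,M,$$ in the sense that $(\gamma_0,K)$ is feasible for the first problem if and only if there exist $P_0,\dots,P_M\in\mathbb{S}^n$ such that $(\gamma_0,K,P_0,\dots,P_M)$ is feasible for the second (so that the two problems have the same optimal value and the same optimal $(\gamma_0,K)$).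
   Context: $\mathbb{S}^k$ denotes the set of real symmetric $k\times k$ matrices; $A\succeq 0$ (resp. $A\succ0$) means $A$ is symmetric positive semidefinite (resp. definite); $\mathbf{Tr}$ is the trace; $\mathcal{N}(0,X^2)$ is the Gaussian distribution on $\mathbb{R}^n$ with mean $0$ and covariance $X^2$. In each block matrix, $Q_j\in\mathbb{R}^{n\times n}$, $S_j\in\mathbb{R}^{n\times m}$, $R_j\in\mathbb{R}^{m\times m}$. There are $N$ decision makers; $p=p_1+\dots+p_N$ and $m=m_1+\dots+m_N$ with positive integers $p_i,m_i$. The matrix $C$ is the stacked matrix $C=[C_1^T\ \cdots\ C_N^T]^T$ with $C_i\in\mathbb{R}^{p_i\times n}$ (decision maker $i$ observes $y_i=C_ix$). $\mathbb{K}$ is the set of block-diagonal matrices $K=\mathrm{diag}(K_1,\dots,K_N)$ with $K_i\in\mathbb{R}^{m_i\times p_i}$. *)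

theory Defs
  imports "HOL-Probability.Probability" "Jordan_Normal_Form.Matrix"
begin

unbundle no vec_syntax and no inner_syntax
hide_type (open) Finite_Cartesian_Product.vec
hide_const (open) Finite_Cartesian_Product.vec Finite_Cartesian_Product.mat
  Determinants.trace Inner_Product.real_inner_class.inner

definition symmetric_mats :: "nat \<Rightarrow> real mat set" where
  "symmetric_mats k = {A \<in> carrier_mat k k. transpose_mat A = A}"

definition pos_semidef :: "real mat \<Rightarrow> bool" where
  "pos_semidef A \<longleftrightarrow> A \<in> symmetric_mats (dim_row A) \<and>
     (\<forall>v \<in> carrier_vec (dim_row A). 0 \<le> v \<bullet> (A *\<^sub>v v))"

definition pos_def :: "real mat \<Rightarrow> bool" where
  "pos_def A \<longleftrightarrow> A \<in> symmetric_mats (dim_row A) \<and>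
     (\<forall>v \<in> carrier_vec (dim_row A). v \<noteq> 0\<^sub>v (dim_row A) \<longrightarrow> 0 < v \<bullet> (A *\<^sub>v v))"

definition mat_trace :: "real mat \<Rightarrow> real" where
  "mat_trace A = (\<Sum>i<dim_row A. A $$ (i, i))"

definition stack_rows :: "nat \<Rightarrow> real mat list \<Rightarrow> real mat" where
  "stack_rows n As = foldr (@\<^sub>r) As (0\<^sub>m 0 n)"

definition block_diag_mats :: "nat \<Rightarrow> (nat \<Rightarrow> nat) \<Rightarrow> (nat \<Rightarrow> nat) \<Rightarrow> real mat set" where
  "block_diag_mats N m p =
     {diag_block_mat (map B [0..<N]) | B. \<forall>i<N. B i \<in> carrier_mat (m i) (p i)}"

text \<open>
  The normal distribution on the line with given mean and variance; variance 0 gives the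
  point mass. A random vector is Gaussian with mean \<open>\<mu>\<close> and (possibly singular) covariance
  \<open>\<Sigma>\<close> if every linear form \<open>a \<bullet> x\<close> is normal with mean \<open>a \<bullet> \<mu>\<close> and variance \<open>a \<bullet> \<Sigma> a\<close>.
\<close>

definition normal_law :: "real \<Rightarrow> real \<Rightarrow> real measure" where
  "normal_law \<mu> v =
     (if v = 0 then return borel \<mu> else density lborel (\<lambda>t. ennreal (normal_density \<mu> (sqrt v) t)))"

definition gaussian_vector ::
  "'w measure \<Rightarrow> nat \<Rightarrow> ('w \<Rightarrow> real vec) \<Rightarrow> real vec \<Rightarrow> real mat \<Rightarrow> bool" where
  "gaussian_vector \<Omega> n x \<mu> Cov \<longleftrightarrow>
     (\<forall>\<omega> \<in> space \<Omega>. x \<omega> \<in> carrier_vec n) \<and>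
     (\<forall>i<n. (\<lambda>\<omega>. x \<omega> $ i) \<in> borel_measurable \<Omega>) \<and>
     (\<forall>a \<in> carrier_vec n.
        distr \<Omega> borel (\<lambda>\<omega>. a \<bullet> x \<omega>) = normal_law (a \<bullet> \<mu>) (a \<bullet> (Cov *\<^sub>v a)))"

text \<open>
  The bounds \<open>\<gamma> 1, \<dots>, \<gamma> M\<close> are data, while the bound with index 0 is the decision variable
  \<open>\<gamma>\<^sub>0\<close>: the bound in force for index \<open>j\<close> is \<open>(\<gamma>(0 := \<gamma>\<^sub>0)) j\<close>, and \<open>\<gamma> 0\<close> is not used.
\<close>

definition team_feasible ::
  "'w measure \<Rightarrow> ('w \<Rightarrow> real vec) \<Rightarrow> real mat set \<Rightarrow> real mat \<Rightarrow> nat \<Rightarrow>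
   (nat \<Rightarrow> real mat) \<Rightarrow> (nat \<Rightarrow> real mat) \<Rightarrow> (nat \<Rightarrow> real mat) \<Rightarrow> (nat \<Rightarrow> real) \<Rightarrow>
   real \<Rightarrow> real mat \<Rightarrow> bool" where
  "team_feasible \<Omega> x \<K> C M Q S R \<gamma> \<gamma>\<^sub>0 K \<longleftrightarrow> K \<in> \<K> \<and>
     (\<forall>j\<le>M. prob_space.expectation \<Omega>
        (\<lambda>\<omega>. (x \<omega> @\<^sub>v (K *\<^sub>v (C *\<^sub>v x \<omega>))) \<bullet>
             (four_block_mat (Q j) (S j) (transpose_mat (S j)) (R j) *\<^sub>v
              (x \<omega> @\<^sub>v (K *\<^sub>v (C *\<^sub>v x \<omega>)))))
        \<le> (\<gamma>(0 := \<gamma>\<^sub>0)) j)"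

definition sdp_feasible ::
  "nat \<Rightarrow> real mat \<Rightarrow> real mat set \<Rightarrow> real mat \<Rightarrow> nat \<Rightarrow>
   (nat \<Rightarrow> real mat) \<Rightarrow> (nat \<Rightarrow> real mat) \<Rightarrow> (nat \<Rightarrow> real mat) \<Rightarrow> (nat \<Rightarrow> real) \<Rightarrow>
   real \<Rightarrow> real mat \<Rightarrow> (nat \<Rightarrow> real mat) \<Rightarrow> bool" where
  "sdp_feasible n X \<K> C M Q S R \<gamma> \<gamma>\<^sub>0 K P \<longleftrightarrow> K \<in> \<K> \<and>
     (\<forall>j\<le>M. P j \<in> symmetric_mats n \<and>
        mat_trace (P j) \<le> (\<gamma>(0 := \<gamma>\<^sub>0)) j \<and>
        pos_semidef (four_block_mat
          (P j - X * Q j * X - X * S j * K * C * X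
             - X * transpose_mat C * transpose_mat K * transpose_mat (S j) * X)
          (X * transpose_mat C * transpose_mat K * R j)
          (R j * K * C * X)
          (R j)))"

end

theory Submission
  imports Defs
begin

text \<open>
  For fixed \<open>K\<close> the cost with index \<open>j\<close> is a quadratic form \<open>x \<bullet> G\<^sub>j x\<close> of the Gaussian
  vector, with mean \<open>Tr (X G\<^sub>j X)\<close>, and by a Schur complement the linear matrix inequality says
  \<open>X G\<^sub>j X \<le> P\<^sub>j\<close> in the Loewner order. So \<open>Tr P\<^sub>j \<le> \<gamma>\<^sub>j\<close> bounds the cost, and
  \<open>P\<^sub>j = X G\<^sub>j X\<close> attains it.
\<close>

section \<open>Quadratic forms, semidefiniteness and the Schur complement\<close>

lemma symmetric_matsD:
  assumes "A \<in> symmetric_mats k"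
  shows "A \<in> carrier_mat k k" "transpose_mat A = A"
  using assms by (auto simp: symmetric_mats_def)

lemma pos_semidef_iff:
  assumes "A \<in> carrier_mat k k"
  shows "pos_semidef A \<longleftrightarrow> transpose_mat A = A \<and> (\<forall>v \<in> carrier_vec k. 0 \<le> v \<bullet> (A *\<^sub>v v))"
  using assms by (auto simp: pos_semidef_def symmetric_mats_def)

lemma pos_def_imp_pos_semidef:
  assumes A: "A \<in> carrier_mat k k" and "pos_def A"
  shows "pos_semidef A"
proof -
  have "0 \<le> v \<bullet> (A *\<^sub>v v)" if v: "v \<in> carrier_vec k" for v
  proof (cases "v = 0\<^sub>v k")
    case True
    then show ?thesis using mult_mat_vec_carrier[OF A v] by simp
  next
    case False
    then show ?thesis using assms v by (simp add: pos_def_def less_imp_le)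
  qed
  then show ?thesis
    using assms by (simp add: pos_semidef_iff pos_def_def symmetric_mats_def)
qed

lemma quadratic_form_four_block_mat:
  fixes A B C D :: "real mat"
  assumes "A \<in> carrier_mat n n" "B \<in> carrier_mat n r" "C \<in> carrier_mat r n" "D \<in> carrier_mat r r"
    and "u \<in> carrier_vec n" "v \<in> carrier_vec r"
  shows "(u @\<^sub>v v) \<bullet> (four_block_mat A B C D *\<^sub>v (u @\<^sub>v v))
    = u \<bullet> (A *\<^sub>v u) + u \<bullet> (B *\<^sub>v v) + v \<bullet> (C *\<^sub>v u) + v \<bullet> (D *\<^sub>v v)"
proof -
  have "(u @\<^sub>v v) \<bullet> (four_block_mat A B C D *\<^sub>v (u @\<^sub>v v))
      = u \<bullet> (A *\<^sub>v u + B *\<^sub>v v) + v \<bullet> (C *\<^sub>v u + D *\<^sub>v v)"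
    using assms by (simp add: four_block_mat_mult_vec[of _ n n _ r _ r] scalar_prod_append[of _ n _ r])
  then show ?thesis
    using assms by (simp add: scalar_prod_add_distrib[of _ n] scalar_prod_add_distrib[of _ r])
qed

lemma scalar_prod_transpose_mult_vec:
  fixes A :: "real mat"
  assumes "A \<in> carrier_mat r n" "x \<in> carrier_vec n" "y \<in> carrier_vec r"
  shows "x \<bullet> (transpose_mat A *\<^sub>v y) = (A *\<^sub>v x) \<bullet> y"
  using transpose_vec_mult_scalar[OF assms] assms
  by (metis comm_scalar_prod mult_mat_vec_carrier transpose_carrier_mat)

text \<open>Supplies the symmetry of every product of this shape below: \<open>F\<^sup>T R F\<close>
  in the Schur complement, \<open>L\<^sup>T R L\<close> in the closed-loop cost and, since X is its
  own transpose, X Q X and X G X.\<close>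

lemma symmetric_mats_congruence:
  assumes A: "A \<in> symmetric_mats r" and F: "F \<in> carrier_mat r n"
  shows "transpose_mat F * A * F \<in> symmetric_mats n"
proof -
  have "transpose_mat (transpose_mat F * A * F) = transpose_mat F * (A * F)"
    using symmetric_matsD[OF A] F
    by (simp add: transpose_mult[of _ n r _ n] transpose_mult[of _ r r _ n])
  then show ?thesis
    using symmetric_matsD[OF A] F by (auto simp: symmetric_mats_def)
qed

text \<open>
  A Schur complement criterion that needs no inverse of the corner block \<open>R\<close>: since the
  off-diagonal block factors through \<open>R\<close>, the quadratic form at \<open>(u, v)\<close> is the sum of
  \<open>u \<bullet> (W - F\<^sup>T R F) u\<close> and the value of \<open>R\<close> at \<open>v + F u\<close>.
\<close>

lemma pos_semidef_four_block_mat_iff: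
  assumes W: "W \<in> symmetric_mats n" and F: "F \<in> carrier_mat r n"
    and R: "R \<in> carrier_mat r r" and R_psd: "pos_semidef R"
  shows "pos_semidef (four_block_mat W (transpose_mat F * R) (R * F) R)
    \<longleftrightarrow> pos_semidef (W - transpose_mat F * R * F)"
    (is "pos_semidef ?B \<longleftrightarrow> pos_semidef ?D")
proof -
  note Wc = symmetric_matsD[OF W]
  have Rt: "transpose_mat R = R" and R_nonneg: "\<And>v. v \<in> carrier_vec r \<Longrightarrow> 0 \<le> v \<bullet> (R *\<^sub>v v)"
    using R_psd R by (auto simp: pos_semidef_iff)
  have FRF: "transpose_mat F * R * F \<in> symmetric_mats n"
    using R Rt F by (intro symmetric_mats_congruence) (auto simp: symmetric_mats_def)
  have carrier: "?B \<in> carrier_mat (n + r) (n + r)" "?D \<in> carrier_mat n n"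
    using Wc F R by auto
  have "transpose_mat ?B = ?B"
    using Wc F R Rt
    by (simp add: transpose_four_block_mat[of _ n n _ r _ r] transpose_mult[of _ n r _ r]
        transpose_mult[of _ r r _ n])
  moreover have "transpose_mat ?D = ?D"
    using Wc(2) symmetric_matsD[OF FRF] Wc(1)
    by (simp add: transpose_minus[of _ n n])
  moreover have form: "(u @\<^sub>v v) \<bullet> (?B *\<^sub>v (u @\<^sub>v v))
      = u \<bullet> (?D *\<^sub>v u) + (v + F *\<^sub>v u) \<bullet> (R *\<^sub>v (v + F *\<^sub>v u))"
    if u: "u \<in> carrier_vec n" and v: "v \<in> carrier_vec r" for u v
  proof -
    define w where "w = F *\<^sub>v u"
    have w: "w \<in> carrier_vec r" using F u by (simp add: w_def)
    have "u \<bullet> (?D *\<^sub>v u) = u \<bullet> (W *\<^sub>v u) - w \<bullet> (R *\<^sub>v w)"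
      using Wc F R u w
      by (simp add: minus_mult_distrib_mat_vec[of _ n n] scalar_prod_minus_distrib[of _ n]
          assoc_mult_mat_vec[of _ n r _ n] assoc_mult_mat_vec[of _ n r _ r]
          scalar_prod_transpose_mult_vec[of _ r n] flip: w_def)
    moreover have "(u @\<^sub>v v) \<bullet> (?B *\<^sub>v (u @\<^sub>v v))
        = u \<bullet> (W *\<^sub>v u) + w \<bullet> (R *\<^sub>v v) + v \<bullet> (R *\<^sub>v w) + v \<bullet> (R *\<^sub>v v)"
      using Wc F R u v w
      by (simp add: quadratic_form_four_block_mat[of _ n _ r] assoc_mult_mat_vec[of _ n r _ r]
          assoc_mult_mat_vec[of _ r r _ n] scalar_prod_transpose_mult_vec[of _ r n] flip: w_def)
    moreover have "(v + w) \<bullet> (R *\<^sub>v (v + w))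
        = v \<bullet> (R *\<^sub>v v) + v \<bullet> (R *\<^sub>v w) + w \<bullet> (R *\<^sub>v v) + w \<bullet> (R *\<^sub>v w)"
      using R v w
      by (simp add: mult_add_distrib_mat_vec[of _ r r] scalar_prod_add_distrib[of _ r]
          add_scalar_prod_distrib[of _ r])
    ultimately show ?thesis by (simp flip: w_def)
  qed
  moreover have "(\<forall>z \<in> carrier_vec (n + r). 0 \<le> z \<bullet> (?B *\<^sub>v z))
      \<longleftrightarrow> (\<forall>u \<in> carrier_vec n. 0 \<le> u \<bullet> (?D *\<^sub>v u))"
  proof (intro iffI ballI)
    fix u :: "real vec"
    assume B: "\<forall>z \<in> carrier_vec (n + r). 0 \<le> z \<bullet> (?B *\<^sub>v z)" and u: "u \<in> carrier_vec n"
    \<comment> \<open>The choice v = - F u makes v + F u vanish, so the block form at (u, v) equals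
      the form of the Schur complement at u.\<close>
    have v: "- (F *\<^sub>v u) \<in> carrier_vec r" using F u by simp
    then have "- (F *\<^sub>v u) + F *\<^sub>v u = 0\<^sub>v r"
      using F u by simp
    moreover have "0 \<le> (u @\<^sub>v - (F *\<^sub>v u)) \<bullet> (?B *\<^sub>v (u @\<^sub>v - (F *\<^sub>v u)))"
      using B u v by (metis append_carrier_vec)
    ultimately show "0 \<le> u \<bullet> (?D *\<^sub>v u)"
      using form[OF u v] R by simp
  next
    fix z :: "real vec"
    assume D: "\<forall>u \<in> carrier_vec n. 0 \<le> u \<bullet> (?D *\<^sub>v u)" and z: "z \<in> carrier_vec (n + r)"
    \<comment> \<open>Every z splits as (u, v), and then both summands in \<open>form\<close> are
      nonnegative, the second one by \<open>R_nonneg\<close>.\<close>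
    have uv: "vec_first z n \<in> carrier_vec n" "vec_last z r \<in> carrier_vec r"
      by simp_all
    moreover have "vec_last z r + F *\<^sub>v vec_first z n \<in> carrier_vec r"
      using F uv by simp
    moreover have "vec_first z n @\<^sub>v vec_last z r = z"
      using z by simp
    ultimately show "0 \<le> z \<bullet> (?B *\<^sub>v z)"
      using form[OF uv] D R_nonneg by (metis add_nonneg_nonneg)
  qed
  ultimately show ?thesis
    using carrier by (simp add: pos_semidef_iff)
qed

section \<open>Traces\<close>

lemma mat_trace_mult:
  assumes "A \<in> carrier_mat n k" "B \<in> carrier_mat k n"
  shows "mat_trace (A * B) = (\<Sum>i<n. \<Sum>j<k. A $$ (i, j) * B $$ (j, i))"
  using assms by (simp add: mat_trace_def scalar_prod_def atLeast0LessThan)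

lemma mat_trace_mult_commute:
  assumes "A \<in> carrier_mat n k" "B \<in> carrier_mat k n"
  shows "mat_trace (A * B) = mat_trace (B * A)"
  unfolding mat_trace_mult[OF assms] mat_trace_mult[OF assms(2,1)]
  by (subst sum.swap) (simp add: mult.commute)

lemma mat_trace_minus:
  assumes "A \<in> carrier_mat n n" "B \<in> carrier_mat n n"
  shows "mat_trace (A - B) = mat_trace A - mat_trace B"
  using assms by (simp add: mat_trace_def sum_subtractf)

text \<open>The case i = j serves the sign of a trace; the general case lets polarization read off
  single entries of the covariance.\<close>

lemma bilinear_form_unit_vec:
  fixes A :: "real mat"
  assumes "A \<in> carrier_mat n n" "i < n" "j < n"
  shows "unit_vec n i \<bullet> (A *\<^sub>v unit_vec n j) = A $$ (i, j)"
  using assms by (simp add: scalar_prod_left_unit[of _ n] scalar_prod_right_unit)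

text \<open>Each diagonal entry is the value of the form at a unit vector. Applied to a difference,
  this makes the trace monotone for the Loewner order.\<close>

lemma mat_trace_nonneg:
  assumes "pos_semidef A"
  shows "0 \<le> mat_trace A"
  unfolding mat_trace_def
proof (rule sum_nonneg)
  fix i assume "i \<in> {..<dim_row A}"
  moreover have "A \<in> carrier_mat (dim_row A) (dim_row A)"
    using assms by (auto simp: pos_semidef_def symmetric_mats_def)
  ultimately show "0 \<le> A $$ (i, i)"
    using assms bilinear_form_unit_vec[of A "dim_row A" i i]
    unfolding pos_semidef_def by (metis lessThan_iff unit_vec_carrier)
qed

section \<open>Second moments of a Gaussian vector\<close>

text \<open>The form \<open>has_bochner_integral\<close> carries integrability along with the value,
  so that moments can later be added and subtracted without separate integrability proofs.\<close>

lemma second_moment_normal_law: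
  assumes "0 \<le> v"
  shows "has_bochner_integral (normal_law 0 v) (\<lambda>t. t\<^sup>2) v"
proof (cases "v = 0")
  case True
  \<comment> \<open>The two integrands agree at 0, which is all that the point mass sees.\<close>
  have "has_bochner_integral (return borel 0) (\<lambda>t::real. t\<^sup>2) 0
      \<longleftrightarrow> has_bochner_integral (return borel 0) (\<lambda>t::real. 0::real) 0"
    by (rule has_bochner_integral_cong_AE) (auto simp: AE_return)
  then show ?thesis using True by (simp add: normal_law_def has_bochner_integral_zero)
next
  case False
  then have "0 < sqrt v" using assms by simp
  \<comment> \<open>The moment of order 2k has the factor (2k)! / (2^k k!), which is 1 for k = 1, so
    the square of \<open>sqrt v\<close> remains.\<close>
  from normal_moment_even[OF this, of 0 1]
  have "has_bochner_integral lborel (\<lambda>t. normal_density 0 (sqrt v) t * t\<^sup>2) v"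
    using assms by (simp add: fact_numeral)
  then have "has_bochner_integral (density lborel (\<lambda>t. ennreal (normal_density 0 (sqrt v) t))) (\<lambda>t. t\<^sup>2) v"
    by (intro has_bochner_integral_density) auto
  then show ?thesis using False by (simp add: normal_law_def)
qed

text \<open>
  Polarization of the one-dimensional second moments. Positive semidefiniteness of the
  covariance rules out the junk value of \<open>normal_law\<close> at a negative variance.
\<close>

lemma gaussian_vector_second_moment:
  assumes gauss: "gaussian_vector \<Omega> n x (0\<^sub>v n) Cov"
    and Cov: "Cov \<in> carrier_mat n n" and psd: "pos_semidef Cov" and i: "i < n" and j: "j < n"
  shows "has_bochner_integral \<Omega> (\<lambda>\<omega>. x \<omega> $ i * x \<omega> $ j) (Cov $$ (i, j))"
proof -
  have x: "\<And>\<omega>. \<omega> \<in> space \<Omega> \<Longrightarrow> x \<omega> \<in> carrier_vec n"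
    and meas: "\<And>i. i < n \<Longrightarrow> (\<lambda>\<omega>. x \<omega> $ i) \<in> borel_measurable \<Omega>"
    and law: "\<And>a. a \<in> carrier_vec n \<Longrightarrow>
      distr \<Omega> borel (\<lambda>\<omega>. a \<bullet> x \<omega>) = normal_law (a \<bullet> 0\<^sub>v n) (a \<bullet> (Cov *\<^sub>v a))"
    using gauss by (auto simp: gaussian_vector_def)
  have linear: "has_bochner_integral \<Omega> (\<lambda>\<omega>. (a \<bullet> x \<omega>)\<^sup>2) (a \<bullet> (Cov *\<^sub>v a))"
    if a: "a \<in> carrier_vec n" for a
  proof -
    \<comment> \<open>The scalar product sums up to the dimension of x \<omega>, which is known to
      be n only on the space of \<Omega>; hence the passage through
      \<open>measurable_cong\<close>.\<close>
    have "(\<lambda>\<omega>. a \<bullet> x \<omega>) \<in> borel_measurable \<Omega> \<longleftrightarrow> (\<lambda>\<omega>. \<Sum>k<n. a $ k * x \<omega> $ k) \<in> borel_measurable \<Omega>"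
      using x by (intro measurable_cong) (force simp: scalar_prod_def atLeast0LessThan)
    then have "(\<lambda>\<omega>. a \<bullet> x \<omega>) \<in> borel_measurable \<Omega>"
      using meas by simp
    moreover have "has_bochner_integral (distr \<Omega> borel (\<lambda>\<omega>. a \<bullet> x \<omega>)) (\<lambda>t. t\<^sup>2) (a \<bullet> (Cov *\<^sub>v a))"
      using law[OF a] second_moment_normal_law psd Cov a by (simp add: pos_semidef_iff)
    ultimately show ?thesis
      by (simp add: has_bochner_integral_iff integrable_distr_eq integral_distr)
  qed
  let ?e = "unit_vec n :: nat \<Rightarrow> real vec"
  have sym: "Cov $$ (j, i) = Cov $$ (i, j)"
    using psd Cov i j by (metis pos_semidef_iff carrier_matD index_transpose_mat(1))
  \<comment> \<open>The identity ((s + t)^2 - (s - t)^2) / 4 = s t with s, t the coordinates i and j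
    of x. On the covariance side the same combination leaves half the sum of the entries (i, j) and
    (j, i), which \<open>sym\<close> identifies. The case i = j is covered as well.\<close>
  have "has_bochner_integral \<Omega> (\<lambda>\<omega>. (((?e i + ?e j) \<bullet> x \<omega>)\<^sup>2 - ((?e i - ?e j) \<bullet> x \<omega>)\<^sup>2) / 4)
      (((?e i + ?e j) \<bullet> (Cov *\<^sub>v (?e i + ?e j)) - (?e i - ?e j) \<bullet> (Cov *\<^sub>v (?e i - ?e j))) / 4)"
    by (intro has_bochner_integral_divide_zero has_bochner_integral_diff linear) auto
  also have "((?e i + ?e j) \<bullet> (Cov *\<^sub>v (?e i + ?e j)) - (?e i - ?e j) \<bullet> (Cov *\<^sub>v (?e i - ?e j))) / 4
      = Cov $$ (i, j)"
    using Cov i j sym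
    by (simp add: mult_add_distrib_mat_vec[of _ n n] mult_minus_distrib_mat_vec[of _ n n]
        scalar_prod_add_distrib[of _ n] add_scalar_prod_distrib[of _ n]
        scalar_prod_minus_distrib[of _ n] minus_scalar_prod_distrib[of _ n]
        bilinear_form_unit_vec del: scalar_prod_left_unit scalar_prod_right_unit)
  finally have *: "has_bochner_integral \<Omega>
      (\<lambda>\<omega>. (((?e i + ?e j) \<bullet> x \<omega>)\<^sup>2 - ((?e i - ?e j) \<bullet> x \<omega>)\<^sup>2) / 4) (Cov $$ (i, j))" .
  have "(((?e i + ?e j) \<bullet> x \<omega>)\<^sup>2 - ((?e i - ?e j) \<bullet> x \<omega>)\<^sup>2) / 4 = x \<omega> $ i * x \<omega> $ j"
    if "\<omega> \<in> space \<Omega>" for \<omega>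
    using x[OF that] i j
    by (simp add: add_scalar_prod_distrib[of _ n] minus_scalar_prod_distrib[of _ n]
        scalar_prod_left_unit power2_eq_square algebra_simps)
  then show ?thesis
    using * by (simp cong: has_bochner_integral_cong)
qed

text \<open>Expanding the form into products of coordinates reduces the mean to the second moments;
  symmetry of the covariance turns the resulting double sum into a trace. As integrability is
  included, the expectation is a genuine one and not the default value 0.\<close>

lemma gaussian_vector_quadratic_form:
  fixes G :: "real mat"
  assumes gauss: "gaussian_vector \<Omega> n x (0\<^sub>v n) Cov"
    and Cov: "Cov \<in> carrier_mat n n" and psd: "pos_semidef Cov" and G: "G \<in> carrier_mat n n"
  shows "has_bochner_integral \<Omega> (\<lambda>\<omega>. x \<omega> \<bullet> (G *\<^sub>v x \<omega>)) (mat_trace (G * Cov))"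
proof -
  have sym: "Cov $$ (j, i) = Cov $$ (i, j)" if "i < n" "j < n" for i j
    using psd Cov that by (metis pos_semidef_iff carrier_matD index_transpose_mat(1))
  have "has_bochner_integral \<Omega> (\<lambda>\<omega>. \<Sum>i<n. \<Sum>j<n. G $$ (i, j) * (x \<omega> $ i * x \<omega> $ j))
      (\<Sum>i<n. \<Sum>j<n. G $$ (i, j) * Cov $$ (i, j))"
    by (intro has_bochner_integral_sum has_bochner_integral_mult_right
        gaussian_vector_second_moment[OF gauss Cov psd]) auto
  also have "(\<Sum>i<n. \<Sum>j<n. G $$ (i, j) * Cov $$ (i, j)) = mat_trace (G * Cov)"
    unfolding mat_trace_mult[OF G Cov] by (intro sum.cong refl) (simp add: sym)
  finally have *: "has_bochner_integral \<Omega>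
      (\<lambda>\<omega>. \<Sum>i<n. \<Sum>j<n. G $$ (i, j) * (x \<omega> $ i * x \<omega> $ j)) (mat_trace (G * Cov))" .
  have "x \<omega> \<bullet> (G *\<^sub>v x \<omega>) = (\<Sum>i<n. \<Sum>j<n. G $$ (i, j) * (x \<omega> $ i * x \<omega> $ j))"
    if "\<omega> \<in> space \<Omega>" for \<omega>
  proof -
    have "x \<omega> \<in> carrier_vec n" using gauss that by (simp add: gaussian_vector_def)
    then show ?thesis
      using G by (simp add: scalar_prod_def atLeast0LessThan sum_distrib_left algebra_simps)
  qed
  then show ?thesis
    using * by (simp cong: has_bochner_integral_cong)
qed

section \<open>Dimensions of the stacked observation matrix and of the block-diagonal gains\<close>

lemma stack_rows_carrier:
  assumes "\<And>i. i < N \<Longrightarrow> A i \<in> carrier_mat (p i) n"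
  shows "stack_rows n (map A [0..<N]) \<in> carrier_mat (\<Sum>i<N. p i) n"
proof -
  \<comment> \<open>The induction needs arbitrary index lists, since the tail of
    \<open>[0..<N]\<close> does not start at 0.\<close>
  have "foldr (@\<^sub>r) (map A is) (0\<^sub>m 0 n) \<in> carrier_mat (\<Sum>i\<leftarrow>is. p i) n"
    if "set is \<subseteq> {..<N}" for "is"
    using that assms by (induction "is") auto
  from this[of "[0..<N]"] show ?thesis
    by (simp add: stack_rows_def interv_sum_list_conv_sum_set_nat atLeast0LessThan subset_eq)
qed

lemma block_diag_mats_carrier:
  assumes "K \<in> block_diag_mats N m p"
  shows "K \<in> carrier_mat (\<Sum>i<N. m i) (\<Sum>i<N. p i)"
proof -
  obtain B where K: "K = diag_block_mat (map B [0..<N])"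
    and B: "\<And>i. i < N \<Longrightarrow> B i \<in> carrier_mat (m i) (p i)"
    using assms by (auto simp: block_diag_mats_def)
  have "(\<Sum>i<N. dim_row (B i)) = (\<Sum>i<N. m i)" "(\<Sum>i<N. dim_col (B i)) = (\<Sum>i<N. p i)"
    using B by (auto intro!: sum.cong)
  then show ?thesis
    unfolding K by (intro carrier_matI)
      (simp_all add: dim_diag_block_mat comp_def interv_sum_list_conv_sum_set_nat atLeast0LessThan)
qed

section \<open>The closed-loop cost matrix and the linear matrix inequality\<close>

text \<open>The matrix of the quadratic cost in \<open>x\<close> under the linear policy \<open>u = L x\<close>.\<close>

definition closed_loop :: "real mat \<Rightarrow> real mat \<Rightarrow> real mat \<Rightarrow> real mat \<Rightarrow> real mat" where
  "closed_loop Q S R L =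
     Q + S * L + transpose_mat L * transpose_mat S + transpose_mat L * R * L"

lemma quadratic_form_closed_loop:
  assumes "Q \<in> carrier_mat n n" "S \<in> carrier_mat n r" "R \<in> carrier_mat r r" "L \<in> carrier_mat r n"
    and "x \<in> carrier_vec n"
  shows "(x @\<^sub>v (L *\<^sub>v x)) \<bullet> (four_block_mat Q S (transpose_mat S) R *\<^sub>v (x @\<^sub>v (L *\<^sub>v x)))
    = x \<bullet> (closed_loop Q S R L *\<^sub>v x)"
  using assms
  by (simp add: closed_loop_def quadratic_form_four_block_mat[of _ n _ r]
      add_mult_distrib_mat_vec[of _ n n] scalar_prod_add_distrib[of _ n]
      assoc_mult_mat_vec[of _ n r _ n] assoc_mult_mat_vec[of _ n r _ r]
      scalar_prod_transpose_mult_vec[of _ r n])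

text \<open>Transposition exchanges the two cross terms and fixes the other two.\<close>

lemma closed_loop_symmetric:
  assumes Q: "Q \<in> symmetric_mats n" and S: "S \<in> carrier_mat n r"
    and R: "R \<in> symmetric_mats r" and L: "L \<in> carrier_mat r n"
  shows "closed_loop Q S R L \<in> symmetric_mats n"
proof -
  note Qc = symmetric_matsD[OF Q] and RL = symmetric_matsD[OF symmetric_mats_congruence[OF R L]]
  have "transpose_mat (closed_loop Q S R L)
      = Q + transpose_mat L * transpose_mat S + S * L + transpose_mat L * R * L"
    unfolding closed_loop_def using Qc S L RL
    by (simp add: transpose_add[of _ n n] transpose_mult[of _ n r _ n])
  also have "\<dots> = closed_loop Q S R L"
    unfolding closed_loop_def using Qc S L RL
    by (simp add: assoc_add_mat[of _ n n] comm_add_mat[of "S * L" n n])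
  finally show ?thesis
    using Qc S L RL by (auto simp: symmetric_mats_def closed_loop_def)
qed

text \<open>The lower left block is R F with F = K C X. The upper left block has only the terms of
  degree at most one in K; the Schur complement subtracts \<open>F\<^sup>T R F\<close>, the missing
  quadratic term, and so completes X G X.\<close>

lemma sdp_block_pos_semidef_iff:
  assumes X: "X \<in> symmetric_mats n" and Q: "Q \<in> symmetric_mats n" and S: "S \<in> carrier_mat n r"
    and R: "R \<in> carrier_mat r r" and R_psd: "pos_semidef R"
    and K: "K \<in> carrier_mat r q" and C: "C \<in> carrier_mat q n" and P: "P \<in> symmetric_mats n"
  shows "pos_semidef (four_block_mat
      (P - X * Q * X - X * S * K * C * X - X * transpose_mat C * transpose_mat K * transpose_mat S * X)
      (X * transpose_mat C * transpose_mat K * R) (R * K * C * X) R)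
    \<longleftrightarrow> pos_semidef (P - X * closed_loop Q S R (K * C) * X)"
proof -
  define L where "L = K * C"
  \<comment> \<open>The two terms linear in K are V and its transpose.\<close>
  define V where "V = X * S * L * X"
  note Xc = symmetric_matsD[OF X] and Qc = symmetric_matsD[OF Q] and Pc = symmetric_matsD[OF P]
  have L: "L \<in> carrier_mat r n" and V: "V \<in> carrier_mat n n"
    using K C Xc S by (auto simp: L_def V_def)
  have Lt: "transpose_mat L = transpose_mat C * transpose_mat K"
    using K C by (simp add: L_def transpose_mult[of _ r q _ n])
  have Vt: "transpose_mat V = X * transpose_mat L * transpose_mat S * X"
    using Xc S L
    by (simp add: V_def transpose_mult[of _ n n _ n] transpose_mult[of _ n r _ n]
        transpose_mult[of _ n n _ r] transpose_mult[of _ r n _ n] assoc_mult_mat[of _ n n _ r _ n] assoc_mult_mat[of _ n r _ n _ n]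
        assoc_mult_mat[of _ n n _ n _ n])
  define U where "U = X * Q * X"
  define W where "W = P - U - V - transpose_mat V"
  have U: "U \<in> symmetric_mats n"
    using symmetric_mats_congruence[OF Q Xc(1)] Xc by (simp add: U_def)
  note Uc = symmetric_matsD[OF U]
  have W: "W \<in> symmetric_mats n"
  proof -
    \<comment> \<open>Transposing W swaps the subtrahends V and its transpose, so the equality is
      checked entrywise.\<close>
    have "P $$ (j, i) = P $$ (i, j)" "U $$ (j, i) = U $$ (i, j)" if "i < n" "j < n" for i j
      using Pc Uc that by (metis carrier_matD index_transpose_mat(1))+
    then show ?thesis
      using Pc(1) Uc(1) V by (auto simp: symmetric_mats_def W_def intro!: eq_matI)
  qed
  have LXt: "transpose_mat (L * X) = X * transpose_mat L"
    using Xc L by (simp add: transpose_mult[of _ r n _ n])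
  \<comment> \<open>The first three summands are what W subtracts from P; the last is the term
    subtracted by the Schur complement.\<close>
  have XGX: "X * closed_loop Q S R L * X
      = U + V + transpose_mat V + transpose_mat (L * X) * R * (L * X)"
    unfolding LXt Vt unfolding U_def V_def closed_loop_def using Xc Qc S R L
    by (simp add: assoc_add_mat[of _ n n] mult_add_distrib_mat[of _ n n _ n] add_mult_distrib_mat[of _ n n _ _ n]
        assoc_mult_mat[of _ n n _ r _ n] assoc_mult_mat[of _ n r _ n _ n]
        assoc_mult_mat[of _ n r _ r _ n] assoc_mult_mat[of _ n n _ n _ n]
        assoc_mult_mat[of _ n n _ r _ r] assoc_mult_mat[of _ r r _ n _ n]
        assoc_mult_mat[of _ r n _ n _ n])
  have "four_block_mat
      (P - X * Q * X - X * S * K * C * X - X * transpose_mat C * transpose_mat K * transpose_mat S * X)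
      (X * transpose_mat C * transpose_mat K * R) (R * K * C * X) R
    = four_block_mat W (transpose_mat (L * X) * R) (R * (L * X)) R"
  proof -
    have "X * S * K * C = X * S * L" "X * transpose_mat C * transpose_mat K = X * transpose_mat L"
      "R * K * C = R * L" "R * L * X = R * (L * X)"
      unfolding Lt unfolding L_def using Xc S R K C
      by (auto simp del: assoc_mult_mat intro!: assoc_mult_mat)
    then show ?thesis by (simp add: W_def U_def V_def[symmetric] Vt LXt)
  qed
  moreover have "W - transpose_mat (L * X) * R * (L * X) = P - X * closed_loop Q S R L * X"
  proof -
    have minus_minus: "A - B - D - E - H = A - (B + D + E + H)"
      if "A \<in> carrier_mat n n" "B \<in> carrier_mat n n" "D \<in> carrier_mat n n"
        "E \<in> carrier_mat n n" "H \<in> carrier_mat n n" for A B D E H :: "real mat"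
      using that by (intro eq_matI) auto
    then show ?thesis
      unfolding XGX W_def using Pc(1) Uc(1) V Xc(1) L R by (intro minus_minus) auto
  qed
  ultimately show ?thesis
    using pos_semidef_four_block_mat_iff[OF W _ R R_psd, of "L * X"] L Xc(1)
    by (simp add: L_def)
qed

section \<open>Equivalence of the team problem and the semidefinite program\<close>

theorem theorem3:
  fixes \<Omega> :: "'w measure" and x :: "'w \<Rightarrow> real vec"
    and n N M :: nat and p m :: "nat \<Rightarrow> nat"
    and X C :: "real mat" and C_blk Q S R :: "nat \<Rightarrow> real mat"
    and \<gamma> :: "nat \<Rightarrow> real"
  defines "\<K> \<equiv> block_diag_mats N m p"
  defines "team \<equiv> team_feasible \<Omega> x \<K> C M Q S R \<gamma>"
  defines "sdp \<equiv> sdp_feasible n X \<K> C M Q S R \<gamma>"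
  assumes "\<And>i. i < N \<Longrightarrow> 0 < p i" and "\<And>i. i < N \<Longrightarrow> 0 < m i"
    and "\<And>i. i < N \<Longrightarrow> C_blk i \<in> carrier_mat (p i) n"
    and "C = stack_rows n (map C_blk [0..<N])"
    and "X \<in> symmetric_mats n"
    and "\<And>j. j \<le> M \<Longrightarrow> Q j \<in> carrier_mat n n"
    and "\<And>j. j \<le> M \<Longrightarrow> S j \<in> carrier_mat n (\<Sum>i<N. m i)"
    and "\<And>j. j \<le> M \<Longrightarrow> R j \<in> carrier_mat (\<Sum>i<N. m i) (\<Sum>i<N. m i)"
    and "\<And>j. j \<le> M \<Longrightarrow>
           four_block_mat (Q j) (S j) (transpose_mat (S j)) (R j)
             \<in> symmetric_mats ((\<Sum>i<N. m i) + n)"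
    and "\<And>j. j \<le> M \<Longrightarrow> pos_def (R j)"
    and "prob_space \<Omega>" and "gaussian_vector \<Omega> n x (0\<^sub>v n) (X * X)"
  shows "(\<forall>\<gamma>\<^sub>0 K. team \<gamma>\<^sub>0 K \<longleftrightarrow> (\<exists>P. sdp \<gamma>\<^sub>0 K P))
    \<and> (INF (\<gamma>\<^sub>0, K) \<in> {(\<gamma>\<^sub>0, K). team \<gamma>\<^sub>0 K}. ereal \<gamma>\<^sub>0)
        = (INF (\<gamma>\<^sub>0, K, P) \<in> {(\<gamma>\<^sub>0, K, P). sdp \<gamma>\<^sub>0 K P}. ereal \<gamma>\<^sub>0)
    \<and> (\<forall>\<gamma>\<^sub>0 K. is_arg_min fst (\<lambda>(\<gamma>\<^sub>0, K). team \<gamma>\<^sub>0 K) (\<gamma>\<^sub>0, K)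
        \<longleftrightarrow> (\<exists>P. is_arg_min fst (\<lambda>(\<gamma>\<^sub>0, K, P). sdp \<gamma>\<^sub>0 K P) (\<gamma>\<^sub>0, K, P)))"
proof -
  define r where "r = (\<Sum>i<N. m i)"
  have C: "C \<in> carrier_mat (\<Sum>i<N. p i) n"
    using stack_rows_carrier[of N C_blk p n] assms(6,7) by simp
  have X: "X \<in> symmetric_mats n" and gauss: "gaussian_vector \<Omega> n x (0\<^sub>v n) (X * X)"
    by fact+
  note Xc = symmetric_matsD[OF X]
  \<comment> \<open>X itself may be indefinite, but the form of X X at v is the squared length of X
    v, so X X is a legitimate covariance.\<close>
  have XX: "X * X \<in> carrier_mat n n" "pos_semidef (X * X)"
  proof -
    have "0 \<le> v \<bullet> (X * X *\<^sub>v v)" if "v \<in> carrier_vec n" for v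
    proof -
      have "v \<bullet> (X * X *\<^sub>v v) = (X *\<^sub>v v) \<bullet> (X *\<^sub>v v)"
        using scalar_prod_transpose_mult_vec[of X n n v "X *\<^sub>v v"] Xc that by simp
      then show ?thesis by (simp add: scalar_prod_def sum_nonneg)
    qed
    then show "pos_semidef (X * X)"
      using Xc by (simp add: pos_semidef_iff[of _ n] transpose_mult[of _ n n _ n])
    show "X * X \<in> carrier_mat n n"
      using Xc by simp
  qed
  have S: "S j \<in> carrier_mat n r" and R: "R j \<in> carrier_mat r r"
    and Q: "Q j \<in> symmetric_mats n" and R_psd: "pos_semidef (R j)" if "j \<le> M" for j
  proof -
    show S: "S j \<in> carrier_mat n r" and R: "R j \<in> carrier_mat r r"
      using assms(10,11) that by (auto simp: r_def)
    have Q: "Q j \<in> carrier_mat n n" using assms(9) that .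
    show R_psd: "pos_semidef (R j)"
      using pos_def_imp_pos_semidef R assms(13) that by blast
    have "transpose_mat (four_block_mat (Q j) (S j) (transpose_mat (S j)) (R j))
        = four_block_mat (Q j) (S j) (transpose_mat (S j)) (R j)"
      using assms(12)[OF that] by (rule symmetric_matsD(2))
    then have blocks: "four_block_mat (transpose_mat (Q j)) (S j) (transpose_mat (S j)) (transpose_mat (R j))
        = four_block_mat (Q j) (S j) (transpose_mat (S j)) (R j)"
      using Q S R by (simp add: transpose_four_block_mat[of _ n n _ r _ r])
    \<comment> \<open>Symmetry of Q is contained in that of the whole block matrix: compare the
      entries of the upper left corner.\<close>
    have "transpose_mat (Q j) = Q j"
    proof (rule eq_matI)
      fix a b assume "a < dim_row (Q j)" "b < dim_col (Q j)"
      then show "transpose_mat (Q j) $$ (a, b) = Q j $$ (a, b)"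
        using arg_cong[OF blocks, of "\<lambda>A. A $$ (a, b)"] Q S R by simp
    qed (use Q in auto)
    then show "Q j \<in> symmetric_mats n" using Q by (simp add: symmetric_mats_def)
  qed
  define G where "G j K = closed_loop (Q j) (S j) (R j) (K * C)" for j K
  have G: "G j K \<in> symmetric_mats n" if "j \<le> M" "K \<in> \<K>" for j K
    unfolding G_def
  proof (rule closed_loop_symmetric[OF Q S])
    show "R j \<in> symmetric_mats r"
      using R[OF that(1)] R_psd[OF that(1)] by (auto simp: pos_semidef_iff symmetric_mats_def)
    show "K * C \<in> carrier_mat r n"
      using block_diag_mats_carrier[of K N m p] that C by (simp add: \<K>_def r_def)
  qed (use that in auto)
  have cost: "prob_space.expectation \<Omega>
        (\<lambda>\<omega>. (x \<omega> @\<^sub>v (K *\<^sub>v (C *\<^sub>v x \<omega>))) \<bullet>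
             (four_block_mat (Q j) (S j) (transpose_mat (S j)) (R j) *\<^sub>v
              (x \<omega> @\<^sub>v (K *\<^sub>v (C *\<^sub>v x \<omega>)))))
      = mat_trace (X * G j K * X)" (is "?E = _") if j: "j \<le> M" and K: "K \<in> \<K>" for j K
  proof -
    have Kc: "K \<in> carrier_mat r (\<Sum>i<N. p i)"
      using block_diag_mats_carrier[of K] K by (simp add: \<K>_def r_def)
    have "?E = prob_space.expectation \<Omega> (\<lambda>\<omega>. x \<omega> \<bullet> (G j K *\<^sub>v x \<omega>))"
    proof (rule Bochner_Integration.integral_cong[OF refl])
      fix \<omega> assume "\<omega> \<in> space \<Omega>"
      then have x: "x \<omega> \<in> carrier_vec n" using gauss by (simp add: gaussian_vector_def)
      have "K *\<^sub>v (C *\<^sub>v x \<omega>) = (K * C) *\<^sub>v x \<omega>"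
        using Kc C x by simp
      then show "(x \<omega> @\<^sub>v (K *\<^sub>v (C *\<^sub>v x \<omega>))) \<bullet>
             (four_block_mat (Q j) (S j) (transpose_mat (S j)) (R j) *\<^sub>v
              (x \<omega> @\<^sub>v (K *\<^sub>v (C *\<^sub>v x \<omega>)))) = x \<omega> \<bullet> (G j K *\<^sub>v x \<omega>)"
        using quadratic_form_closed_loop[OF _ S[OF j] R[OF j] _ x, of "Q j" "K * C"]
          symmetric_matsD(1)[OF Q[OF j]] Kc C by (simp add: G_def)
    qed
    also have "\<dots> = mat_trace (G j K * (X * X))"
      using gaussian_vector_quadratic_form[OF gauss XX symmetric_matsD(1)[OF G[OF j K]]]
      by (rule has_bochner_integral_integral_eq)
    \<comment> \<open>Cyclicity of the trace moves one factor X to the front, giving the symmetric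
      matrix that the Schur complement compares with P.\<close>
    also have "\<dots> = mat_trace (G j K * X * X)"
      using symmetric_matsD(1)[OF G[OF j K]] Xc by simp
    also have "\<dots> = mat_trace (X * (G j K * X))"
      using symmetric_matsD(1)[OF G[OF j K]] Xc by (intro mat_trace_mult_commute) auto
    also have "X * (G j K * X) = X * G j K * X"
      using symmetric_matsD(1)[OF G[OF j K]] Xc by simp
    finally show ?thesis .
  qed
  have sdp_iff: "sdp \<gamma>\<^sub>0 K P \<longleftrightarrow> K \<in> \<K> \<and> (\<forall>j\<le>M. P j \<in> symmetric_mats n \<and>
      mat_trace (P j) \<le> (\<gamma>(0 := \<gamma>\<^sub>0)) j \<and> pos_semidef (P j - X * G j K * X))" for \<gamma>\<^sub>0 K P
    unfolding sdp_def sdp_feasible_def G_def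
    using sdp_block_pos_semidef_iff[OF X Q S R R_psd _ C] block_diag_mats_carrier[of K N m p]
    by (auto simp: \<K>_def r_def)
  have team_iff: "team \<gamma>\<^sub>0 K \<longleftrightarrow> K \<in> \<K> \<and> (\<forall>j\<le>M. mat_trace (X * G j K * X) \<le> (\<gamma>(0 := \<gamma>\<^sub>0)) j)" for \<gamma>\<^sub>0 K
    unfolding team_def team_feasible_def using cost by auto
  have equiv: "team \<gamma>\<^sub>0 K \<longleftrightarrow> (\<exists>P. sdp \<gamma>\<^sub>0 K P)" for \<gamma>\<^sub>0 K
  proof
    assume team: "team \<gamma>\<^sub>0 K"
    have XGX: "X * G j K * X \<in> symmetric_mats n" if "j \<le> M" for j
      using symmetric_mats_congruence[OF G Xc(1)] Xc that team by (simp add: team_iff)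
    \<comment> \<open>For the witness \<open>P j = X * G j K * X\<close> the Schur complement is
      zero and the trace bound is the cost bound itself.\<close>
    have "pos_semidef (X * G j K * X - X * G j K * X)" if "j \<le> M" for j
    proof -
      have "X * G j K * X - X * G j K * X = 0\<^sub>m n n"
        using symmetric_matsD(1)[OF XGX[OF that]] by (rule minus_r_inv_mat)
      then show ?thesis by (auto simp: pos_semidef_iff[of _ n] scalar_prod_def)
    qed
    then have "sdp \<gamma>\<^sub>0 K (\<lambda>j. X * G j K * X)"
      using team XGX by (simp add: team_iff sdp_iff)
    then show "\<exists>P. sdp \<gamma>\<^sub>0 K P" by blast
  next
    assume "\<exists>P. sdp \<gamma>\<^sub>0 K P"
    then obtain P where P: "sdp \<gamma>\<^sub>0 K P" ..
    have "mat_trace (X * G j K * X) \<le> (\<gamma>(0 := \<gamma>\<^sub>0)) j" if j: "j \<le> M" for j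
    proof -
      have "0 \<le> mat_trace (P j - X * G j K * X)"
        using P j by (intro mat_trace_nonneg) (simp add: sdp_iff)
      also have "\<dots> = mat_trace (P j) - mat_trace (X * G j K * X)"
        using P j Xc(1) G[OF j, of K]
        by (intro mat_trace_minus[of _ n]) (auto simp: sdp_iff symmetric_mats_def)
      finally show ?thesis using P j by (force simp: sdp_iff)
    qed
    then show "team \<gamma>\<^sub>0 K" using P by (simp add: team_iff sdp_iff)
  qed
  \<comment> \<open>Both objectives see only \<gamma>\<open>\<^sub>0\<close>, so
    \<open>equiv\<close> gives the same set of attainable values. Infima in \<open>ereal\<close>
    then also cover an infeasible problem.\<close>
  have "(\<lambda>(\<gamma>\<^sub>0, K). ereal \<gamma>\<^sub>0) ` {(\<gamma>\<^sub>0, K). team \<gamma>\<^sub>0 K}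
      = (\<lambda>(\<gamma>\<^sub>0, K, P). ereal \<gamma>\<^sub>0) ` {(\<gamma>\<^sub>0, K, P). sdp \<gamma>\<^sub>0 K P}"
  proof (intro equalityI subsetI)
    fix t
    assume "t \<in> (\<lambda>(\<gamma>\<^sub>0, K). ereal \<gamma>\<^sub>0) ` {(\<gamma>\<^sub>0, K). team \<gamma>\<^sub>0 K}"
    then obtain \<gamma>\<^sub>0 K P where "t = ereal \<gamma>\<^sub>0" "sdp \<gamma>\<^sub>0 K P"
      using equiv by auto
    then show "t \<in> (\<lambda>(\<gamma>\<^sub>0, K, P). ereal \<gamma>\<^sub>0) ` {(\<gamma>\<^sub>0, K, P). sdp \<gamma>\<^sub>0 K P}"
      by (intro image_eqI[of _ _ "(\<gamma>\<^sub>0, K, P)"]) auto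
  next
    fix t
    assume "t \<in> (\<lambda>(\<gamma>\<^sub>0, K, P). ereal \<gamma>\<^sub>0) ` {(\<gamma>\<^sub>0, K, P). sdp \<gamma>\<^sub>0 K P}"
    then obtain \<gamma>\<^sub>0 K where "t = ereal \<gamma>\<^sub>0" "team \<gamma>\<^sub>0 K"
      using equiv by auto
    then show "t \<in> (\<lambda>(\<gamma>\<^sub>0, K). ereal \<gamma>\<^sub>0) ` {(\<gamma>\<^sub>0, K). team \<gamma>\<^sub>0 K}"
      by (intro image_eqI[of _ _ "(\<gamma>\<^sub>0, K)"]) auto
  qed
  \<comment> \<open>P does not change the objective, so by \<open>equiv\<close> a better feasible
    point exists for one problem iff it exists for the other.\<close>
  moreover have "is_arg_min fst (\<lambda>(\<gamma>\<^sub>0, K). team \<gamma>\<^sub>0 K) (\<gamma>\<^sub>0, K)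
      \<longleftrightarrow> (\<exists>P. is_arg_min fst (\<lambda>(\<gamma>\<^sub>0, K, P). sdp \<gamma>\<^sub>0 K P) (\<gamma>\<^sub>0, K, P))" for \<gamma>\<^sub>0 K
    using equiv by (simp add: is_arg_min_def)
  ultimately show ?thesis using equiv by simp
qed

end
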